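(* Let $(\mathbb{N}_0,b,m)$ be a birth-death chain and let $L_c$ be the restriction of its formal Laplacian to the finitely supported functions, viewed as an operator on $\ell^2(\mathbb{N}_0,m)$. Then the following statements are equivalent: (i) $L_c$ is essentially self-adjoint. (ii) $$\sum_{r=0}^\infty \left( \sum_{k=0}^r \frac{1}{b(k,k+1)} \right)^2 m(r+1) = \infty.$$
   Context: A birth-death chain $(\mathbb{N}_0,b,m)$ consists of the vertex set $\mathbb{N}_0=\{0,1,2,\ldots\}$, a symmetric function $b\colon \mathbb{N}_0\times\mathbb{N}_0\to[0,\infty)$ with $b(x,y)>0$ if and only if $|x-y|=1$, and a function $m\colon\mathbb{N}_0\to(0,\infty)$ (vertex measure). All functions are real-valued. $\ell^2(\mathbb{N}_0,m)$ is the Hilbert space of functions $f$ with $\sum_x f^2(x)m(x)<\infty$ and inner product $\langle f,g\rangle=\sum_x f(x)g(x)m(x)$. The formal Laplacian is $\Delta f(x)=\frac{1}{m(x)}\sum_{y} b(x,y)(f(x)-f(y))$. $C_c(\mathbb{N}_0)$ denotes the finitely supported functions and $L_c=\Delta|_{C_c(\mathbb{N}_0)}$, a symmetric positive operator on $\ell^2(\mathbb{N}_0,m)$. $L_c$ is essentially self-adjoint if it has a unique self-adjoint extension, equivalently if its closure is self-adjoint. *)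

theory Defs
  imports Complex_Main "HOL-Library.Extended_Nonnegative_Real"
begin

locale birth_death_chain =
  fixes b :: "nat \<Rightarrow> nat \<Rightarrow> real" and m :: "nat \<Rightarrow> real"
  assumes b_sym: "b x y = b y x"
    and b_nonneg: "0 \<le> b x y"
    and b_pos_iff: "0 < b x y \<longleftrightarrow> \<bar>int x - int y\<bar> = 1"
    and m_pos: "0 < m x"

definition l2 :: "(nat \<Rightarrow> real) \<Rightarrow> (nat \<Rightarrow> real) set" where
  "l2 m = {f. summable (\<lambda>x. (f x)\<^sup>2 * m x)}"

definition l2_inner :: "(nat \<Rightarrow> real) \<Rightarrow> (nat \<Rightarrow> real) \<Rightarrow> (nat \<Rightarrow> real) \<Rightarrow> real" where
  "l2_inner m f g = (\<Sum>x. f x * g x * m x)"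

definition l2_norm :: "(nat \<Rightarrow> real) \<Rightarrow> (nat \<Rightarrow> real) \<Rightarrow> real" where
  "l2_norm m f = sqrt (l2_inner m f f)"

definition l2_dense :: "(nat \<Rightarrow> real) \<Rightarrow> (nat \<Rightarrow> real) set \<Rightarrow> bool" where
  "l2_dense m D \<longleftrightarrow> D \<subseteq> l2 m \<and>
     (\<forall>f \<in> l2 m. \<forall>\<epsilon> > 0. \<exists>g \<in> D. l2_norm m (\<lambda>x. f x - g x) < \<epsilon>)"

text \<open>A possibly unbounded operator on \<open>l2 m\<close> is identified with its graph, so that its domain
  is the \<^const>\<open>Domain\<close> of the graph, and \<open>B\<close> extends \<open>A\<close> iff \<open>A \<subseteq> B\<close>.\<close>

type_synonym op_graph = "((nat \<Rightarrow> real) \<times> (nat \<Rightarrow> real)) set"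

definition linear_operator :: "(nat \<Rightarrow> real) \<Rightarrow> op_graph \<Rightarrow> bool" where
  "linear_operator m A \<longleftrightarrow>
     A \<subseteq> l2 m \<times> l2 m \<and> single_valued A \<and>
     ((\<lambda>x. 0), (\<lambda>x. 0)) \<in> A \<and>
     (\<forall>f f' g g'. (f, f') \<in> A \<longrightarrow> (g, g') \<in> A \<longrightarrow>
        ((\<lambda>x. f x + g x), (\<lambda>x. f' x + g' x)) \<in> A) \<and>
     (\<forall>c f f'. (f, f') \<in> A \<longrightarrow> ((\<lambda>x. c * f x), (\<lambda>x. c * f' x)) \<in> A)"

definition adjoint_operator :: "(nat \<Rightarrow> real) \<Rightarrow> op_graph \<Rightarrow> op_graph" where
  "adjoint_operator m A =
     {(g, h). g \<in> l2 m \<and> h \<in> l2 m \<and> (\<forall>(f, f') \<in> A. l2_inner m f' g = l2_inner m f h)}"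

definition self_adjoint :: "(nat \<Rightarrow> real) \<Rightarrow> op_graph \<Rightarrow> bool" where
  "self_adjoint m A \<longleftrightarrow>
     linear_operator m A \<and> l2_dense m (Domain A) \<and> adjoint_operator m A = A"

definition essentially_self_adjoint :: "(nat \<Rightarrow> real) \<Rightarrow> op_graph \<Rightarrow> bool" where
  "essentially_self_adjoint m A \<longleftrightarrow> (\<exists>!B. self_adjoint m B \<and> A \<subseteq> B)"

text \<open>On a birth-death chain the sum over \<open>y\<close> has at most two nonzero terms, so the formal
  Laplacian is defined on all functions.\<close>

definition formal_laplacian ::
  "(nat \<Rightarrow> nat \<Rightarrow> real) \<Rightarrow> (nat \<Rightarrow> real) \<Rightarrow> (nat \<Rightarrow> real) \<Rightarrow> nat \<Rightarrow> real" where
  "formal_laplacian b m f x = 1 / m x * (\<Sum>y. b x y * (f x - f y))"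

definition finitely_supported :: "(nat \<Rightarrow> real) set" where
  "finitely_supported = {f. finite {x. f x \<noteq> 0}}"

definition minimal_laplacian ::
  "(nat \<Rightarrow> nat \<Rightarrow> real) \<Rightarrow> (nat \<Rightarrow> real) \<Rightarrow> op_graph" where
  "minimal_laplacian b m = {(f, formal_laplacian b m f) | f. f \<in> finitely_supported}"

end

theory Submission
  imports Defs "HOL-Analysis.Convex"
begin

text \<open>For \<open>f, g\<close> in the domain of the maximal Laplacian \<open>T\<close> (the adjoint of \<open>L\<^sub>c\<close>), Green's formula
  shows that the Wronskian of \<open>f\<close> and \<open>g\<close> has a limit at infinity, equal to
  \<open>\<langle>Tf, g\<rangle> - \<langle>f, Tg\<rangle>\<close>. Let \<open>v(n) = \<Sum>k<n. 1 / b(k, k+1)\<close>; condition (ii) says \<open>v \<notin> \<ell>\<^sup>2\<close>.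

  If \<open>v \<in> \<ell>\<^sup>2\<close>, then also \<open>1 \<in> \<ell>\<^sup>2\<close>, and by the Pluecker identity for Wronskians requiring
  a vanishing Wronskian at infinity with either \<open>1\<close> or \<open>v\<close> gives two distinct self-adjoint
  restrictions of \<open>T\<close>.

  If \<open>v \<notin> \<ell>\<^sup>2\<close>, all Wronskians vanish at infinity, so \<open>T\<close> is symmetric. The flux of \<open>f\<close> at \<open>n\<close> is
  the sum of \<open>m \<Delta>f\<close> over \<open>{0..n}\<close>. If \<open>m\<close> is summable, the total sum is \<open>0\<close>, since otherwise \<open>f\<close> would
  grow like \<open>v\<close>, so the flux is also minus the sum over \<open>{n+1..}\<close>. By Cauchy--Schwarz its square
  is bounded by a constant times \<open>M(n) = m{0..n}\<close> or, for summable \<open>m\<close>, \<open>M(n) = m{n+1..}\<close>. A Wronskian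
  bounded away from \<open>0\<close> would force \<open>f\<^sup>2 + g\<^sup>2 \<ge> c / M\<close>, but \<open>m / M\<close> is not summable by Abel--Dini.\<close>

section \<open>Weighted series\<close>

lemma weighted_sum_cauchy_schwarz:
  fixes h w :: "'a \<Rightarrow> real"
  assumes "\<And>x. 0 \<le> w x"
  shows "(\<Sum>x\<in>A. h x * w x)\<^sup>2 \<le> (\<Sum>x\<in>A. (h x)\<^sup>2 * w x) * (\<Sum>x\<in>A. w x)"
proof -
  have "(\<Sum>x\<in>A. h x * w x) = (\<Sum>x\<in>A. (h x * sqrt (w x)) * sqrt (w x))"
    using assms by (intro sum.cong) (auto simp: mult.assoc)
  moreover have "(\<Sum>x\<in>A. (h x * sqrt (w x)) * sqrt (w x))\<^sup>2
      \<le> (\<Sum>x\<in>A. (h x * sqrt (w x))\<^sup>2) * (\<Sum>x\<in>A. (sqrt (w x))\<^sup>2)"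
    by (rule Cauchy_Schwarz_ineq_sum)
  ultimately show ?thesis using assms by (simp add: power_mult_distrib)
qed

lemma weighted_suminf_cauchy_schwarz:
  fixes h w :: "nat \<Rightarrow> real"
  assumes "\<And>x. 0 \<le> w x" "summable (\<lambda>x. (h x)\<^sup>2 * w x)" "summable w" "summable (\<lambda>x. h x * w x)"
  shows "(\<Sum>x. h x * w x)\<^sup>2 \<le> (\<Sum>x. (h x)\<^sup>2 * w x) * (\<Sum>x. w x)"
proof (rule LIMSEQ_le)
  show "(\<lambda>n. (\<Sum>x<n. h x * w x)\<^sup>2) \<longlonglongrightarrow> (\<Sum>x. h x * w x)\<^sup>2"
    by (intro tendsto_power summable_LIMSEQ assms)
  show "(\<lambda>n. (\<Sum>x<n. (h x)\<^sup>2 * w x) * (\<Sum>x<n. w x)) \<longlonglongrightarrow> (\<Sum>x. (h x)\<^sup>2 * w x) * (\<Sum>x. w x)"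
    by (intro tendsto_mult summable_LIMSEQ assms)
qed (intro exI allI impI weighted_sum_cauchy_schwarz assms(1))

text \<open>Abel--Dini: \<open>\<Sum>n. m n / M n\<close> diverges when \<open>M n\<close> is a partial sum of a divergent series
  \<open>m\<close> or a tail of a convergent one.\<close>

lemma abel_dini_partial_sums:
  fixes a m :: "nat \<Rightarrow> real"
  assumes m: "\<And>x. 0 \<le> m x" and a: "\<And>x. 0 \<le> a x"
    and s: "summable (\<lambda>x. a x * m x)" and div: "\<not> summable m" and C: "0 < C"
  shows "\<exists>n\<ge>N. a n * (\<Sum>x\<le>n. m x) < C"
proof (rule ccontr)
  assume "\<not> ?thesis"
  then have ge: "C \<le> a n * (\<Sum>x\<le>n. m x)" if "N \<le> n" for n using that by force
  have "0 < C / 2" using C by simp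
  then obtain K0 where K0: "\<And>i n. K0 \<le> i \<Longrightarrow> norm (\<Sum>x=i..<n. a x * m x) < C / 2"
    using s unfolding summable_Cauchy by blast
  define K where "K = max K0 N"
  define M where "M n = (\<Sum>x<n. m x)" for n
  have M_nonneg: "0 \<le> M n" for n unfolding M_def by (intro sum_nonneg m)
  have "\<exists>n. 2 * M K < M n"
  proof (rule ccontr)
    assume "\<not> ?thesis"
    then have "summable m"
      by (intro summableI_nonneg_bounded[where x = "2 * M K"] m) (auto simp: M_def not_less)
    with div show False ..
  qed
  then obtain n where n: "2 * M K < M n" ..
  have "K \<le> n"
  proof (rule ccontr)
    assume "\<not> K \<le> n"
    then have "M n \<le> M K" unfolding M_def by (intro sum_mono2) (auto simp: m)
    with n M_nonneg[of K] show False by linarith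
  qed
  \<comment> \<open>The partial sums have more than doubled since \<open>K\<close>, so
    \<open>M n - M K\<close> exceeds half of \<open>M n\<close>; the bound \<open>C / 2\<close> on
    the block of \<open>a * m\<close> allows at most half.\<close>
  have "C * (M n - M K) = (\<Sum>x=K..<n. C * m x)"
    unfolding M_def using \<open>K \<le> n\<close>
    by (simp add: sum_distrib_left[symmetric] lessThan_atLeast0 sum_diff_nat_ivl)
  also have "\<dots> \<le> (\<Sum>x=K..<n. a x * m x * M n)"
  proof (rule sum_mono)
    fix x assume x: "x \<in> {K..<n}"
    then have "(\<Sum>x\<le>x. m x) \<le> M n"
      unfolding M_def by (intro sum_mono2) (auto simp: m)
    then have "a x * (\<Sum>x\<le>x. m x) \<le> a x * M n" using a by (rule mult_left_mono)
    moreover have "C \<le> a x * (\<Sum>x\<le>x. m x)" using x ge[of x] by (simp add: K_def)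
    ultimately have "C * m x \<le> a x * M n * m x" using m by (intro mult_right_mono) auto
    then show "C * m x \<le> a x * m x * M n" by (simp add: mult_ac)
  qed
  also have "\<dots> = (\<Sum>x=K..<n. a x * m x) * M n" by (simp add: sum_distrib_right)
  also have "\<dots> \<le> C / 2 * M n"
    using K0[of K n] M_nonneg by (intro mult_right_mono) (auto simp: K_def)
  finally have "C * (M n - 2 * M K) \<le> 0" by (simp add: algebra_simps)
  with C n show False by (simp add: mult_le_0_iff)
qed

lemma abel_dini_tails:
  fixes a m :: "nat \<Rightarrow> real"
  assumes m: "\<And>x. 0 < m x" and a: "\<And>x. 0 \<le> a x"
    and s: "summable (\<lambda>x. a x * m x)" and conv: "summable m" and C: "0 < C"
  shows "\<exists>n\<ge>N. a n * (\<Sum>i. m (i + Suc n)) < C"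
proof (rule ccontr)
  assume "\<not> ?thesis"
  then have ge: "C \<le> a n * (\<Sum>i. m (i + Suc n))" if "N \<le> n" for n using that by force
  have shift: "summable (\<lambda>i. m (i + k))" for k using conv by (simp add: summable_iff_shift)
  have shift': "summable (\<lambda>i. a (i + k) * m (i + k))" for k
    using s summable_iff_shift[of "\<lambda>x. a x * m x" k] by simp
  obtain K0 where K0: "\<And>n. K0 \<le> n \<Longrightarrow> norm (\<Sum>i. a (i + n) * m (i + n)) < C"
    using suminf_exist_split[OF C s] by blast
  define K where "K = max K0 N"
  define R where "R n = (\<Sum>i. m (i + n))" for n
  have R_pos: "0 < R n" for n unfolding R_def by (intro suminf_pos shift m)
  have R_anti: "R (K + j) \<le> R K" for j
  proof (induction j)
    case (Suc j)
    have "R (K + j) = R (K + Suc j) + m (K + j)"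
      unfolding R_def using suminf_split_head[OF shift[of "K + j"]] by simp
    with Suc m[of "K + j"] show ?case by linarith
  qed simp
  \<comment> \<open>All later tails are at most \<open>R K\<close>, so the negated claim gives
    \<open>C / R K \<le> a x\<close> for \<open>x\<close> from \<open>K\<close> on. Weighting by
    \<open>m\<close> makes the tail of \<open>a * m\<close> at least \<open>C\<close>, against the
    choice of \<open>K\<close>.\<close>
  have "C * R K = (\<Sum>i. C * m (i + K))" unfolding R_def by (rule suminf_mult[OF shift, symmetric])
  also have "\<dots> \<le> (\<Sum>i. a (i + K) * m (i + K) * R K)"
  proof (rule suminf_le)
    fix i
    have "C \<le> a (i + K) * R (Suc (i + K))" using ge[of "i + K"] by (simp add: K_def R_def)
    also have "\<dots> \<le> a (i + K) * R K" using R_anti[of "Suc i"] a by (intro mult_left_mono) (auto simp: add.commute)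
    finally have "C * m (i + K) \<le> a (i + K) * R K * m (i + K)"
      using m by (intro mult_right_mono) (auto intro: less_imp_le)
    then show "C * m (i + K) \<le> a (i + K) * m (i + K) * R K" by (simp add: mult_ac)
  qed (intro summable_mult summable_mult2 shift shift')+
  also have "\<dots> = (\<Sum>i. a (i + K) * m (i + K)) * R K" by (rule suminf_mult2[OF shift', symmetric])
  also have "\<dots> < C * R K"
    using K0[of K] R_pos by (intro mult_strict_right_mono) (auto simp: K_def)
  finally show False by simp
qed

section \<open>Weighted square-summable sequences\<close>

lemma l2_zero: "(\<lambda>x. 0) \<in> l2 m"
  by (simp add: l2_def)

lemma l2_scale: "f \<in> l2 m \<Longrightarrow> (\<lambda>x. c * f x) \<in> l2 m"
  unfolding l2_def
  by (simp add: power_mult_distrib mult.assoc summable_mult)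

lemma finitely_supported_subset_l2: "finitely_supported \<subseteq> l2 m"
proof
  fix f :: "nat \<Rightarrow> real"
  assume "f \<in> finitely_supported"
  then have fin: "finite {x. f x \<noteq> 0}" by (simp add: finitely_supported_def)
  have "summable (\<lambda>x. (f x)\<^sup>2 * m x)" by (rule summable_finite[OF fin]) simp
  then show "f \<in> l2 m" by (simp add: l2_def)
qed

lemma finitely_supported_bound:
  assumes "f \<in> finitely_supported"
  obtains n where "\<And>x. n \<le> x \<Longrightarrow> f x = (0::real)"
proof -
  have "finite {x. f x \<noteq> 0}" using assms by (simp add: finitely_supported_def)
  then obtain n where "\<forall>x\<in>{x. f x \<noteq> 0}. x < n"
    using finite_nat_set_iff_bounded by blast
  then show thesis using that[of n] by force
qed

locale weighted_l2 =
  fixes m :: "nat \<Rightarrow> real"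
  assumes m_nonneg: "0 \<le> m x"
begin

lemma l2_mult_summable:
  assumes "f \<in> l2 m" "g \<in> l2 m"
  shows "summable (\<lambda>x. f x * g x * m x)"
proof (rule summable_comparison_test')
  show "summable (\<lambda>x. (f x)\<^sup>2 * m x + (g x)\<^sup>2 * m x)"
    using assms by (auto simp: l2_def intro: summable_add)
next
  fix x
  have "0 \<le> (\<bar>f x\<bar> - \<bar>g x\<bar>)\<^sup>2" by simp
  then have "2 * \<bar>f x * g x\<bar> \<le> (f x)\<^sup>2 + (g x)\<^sup>2"
    by (simp add: power2_diff abs_mult)
  then have "\<bar>f x * g x\<bar> \<le> (f x)\<^sup>2 + (g x)\<^sup>2"
    by (smt (verit) abs_ge_zero)
  then have "\<bar>f x * g x\<bar> * m x \<le> ((f x)\<^sup>2 + (g x)\<^sup>2) * m x"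
    using m_nonneg by (rule mult_right_mono)
  then show "norm (f x * g x * m x) \<le> (f x)\<^sup>2 * m x + (g x)\<^sup>2 * m x"
    using m_nonneg[of x] by (simp add: abs_mult distrib_right)
qed

lemma l2_add:
  assumes "f \<in> l2 m" "g \<in> l2 m"
  shows "(\<lambda>x. f x + g x) \<in> l2 m"
proof -
  have "summable (\<lambda>x. (f x)\<^sup>2 * m x + (g x)\<^sup>2 * m x + 2 * (f x * g x * m x))"
    using assms l2_mult_summable[OF assms]
    by (intro summable_add summable_mult) (auto simp: l2_def)
  then show ?thesis
    by (simp add: l2_def power2_sum algebra_simps)
qed

lemma l2_mono:
  assumes "f \<in> l2 m" "\<And>x. \<bar>g x\<bar> \<le> \<bar>f x\<bar>"
  shows "g \<in> l2 m"
proof -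
  have "norm ((g x)\<^sup>2 * m x) \<le> (f x)\<^sup>2 * m x" for x
    using assms(2)[of x] m_nonneg[of x] 
    by (simp add: abs_mult mult_right_mono abs_le_square_iff)
  then show ?thesis
    using assms(1) unfolding l2_def by (auto intro: summable_comparison_test')
qed

lemma finitely_supported_dense:
  assumes "finitely_supported \<subseteq> D" "D \<subseteq> l2 m"
  shows "l2_dense m D"
  unfolding l2_dense_def
proof (intro conjI ballI allI impI)
  fix f and \<epsilon> :: real
  assume f: "f \<in> l2 m" and "\<epsilon> > 0"
  have s: "summable (\<lambda>x. (f x)\<^sup>2 * m x)" using f by (simp add: l2_def)
  have "0 < \<epsilon>\<^sup>2" using \<open>\<epsilon> > 0\<close> by simp
  then obtain N where N: "norm (\<Sum>i. (f (i + N))\<^sup>2 * m (i + N)) < \<epsilon>\<^sup>2"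
    using suminf_exist_split[OF _ s] by blast
  define g where "g x = (if x < N then f x else 0)" for x
  have "{x. g x \<noteq> 0} \<subseteq> {..<N}" by (auto simp: g_def)
  then have "g \<in> finitely_supported"
    unfolding finitely_supported_def using finite_subset by blast
  moreover have "l2_norm m (\<lambda>x. f x - g x) < \<epsilon>"
  proof -
    let ?d = "\<lambda>x. f x - g x"
    have sd: "summable (\<lambda>x. ?d x * ?d x * m x)"
    proof -
      have "?d \<in> l2 m" by (rule l2_mono[OF f]) (simp add: g_def)
      then show ?thesis by (intro l2_mult_summable)
    qed
    have "l2_inner m ?d ?d = (\<Sum>i. ?d (i + N) * ?d (i + N) * m (i + N)) + (\<Sum>i<N. ?d i * ?d i * m i)"
      unfolding l2_inner_def by (rule suminf_split_initial_segment[OF sd])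
    also have "\<dots> = (\<Sum>i. (f (i + N))\<^sup>2 * m (i + N))"
      by (simp add: g_def power2_eq_square)
    finally have "l2_inner m ?d ?d < \<epsilon>\<^sup>2" using N by simp
    then show ?thesis using \<open>\<epsilon> > 0\<close> by (simp add: l2_norm_def real_less_lsqrt)
  qed
  ultimately show "\<exists>g\<in>D. l2_norm m (\<lambda>x. f x - g x) < \<epsilon>"
    using assms(1) by blast
qed (use assms in blast)

end

section \<open>Wronskians and boundary conditions at infinity\<close>

sublocale birth_death_chain \<subseteq> weighted_l2 m
  by unfold_locales (simp add: m_pos less_imp_le)

context birth_death_chain
begin

text \<open>Discrete counterpart of the quasi-derivative -p f' of a Sturm-Liouville operator, living
  on the edge from \<open>n\<close> to \<open>Suc n\<close>.\<close>

definition flux :: "(nat \<Rightarrow> real) \<Rightarrow> nat \<Rightarrow> real" where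
  "flux f n = b n (Suc n) * (f n - f (Suc n))"

definition wronskian :: "(nat \<Rightarrow> real) \<Rightarrow> (nat \<Rightarrow> real) \<Rightarrow> nat \<Rightarrow> real" where
  "wronskian f g n = flux f n * g n - f n * flux g n"

abbreviation lap :: "(nat \<Rightarrow> real) \<Rightarrow> nat \<Rightarrow> real" where
  "lap \<equiv> formal_laplacian b m"

definition maximal_domain :: "(nat \<Rightarrow> real) set" where
  "maximal_domain = {f \<in> l2 m. lap f \<in> l2 m}"

text \<open>Stated as the defect of symmetry, the quantity that adjoints test; on the maximal domain
  \<open>wronskian_tendsto\<close> identifies it with a limit of Wronskians.\<close>

definition boundary_form :: "(nat \<Rightarrow> real) \<Rightarrow> (nat \<Rightarrow> real) \<Rightarrow> real" where
  "boundary_form f g = l2_inner m (lap f) g - l2_inner m f (lap g)"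

text \<open>The maximal Laplacian is the case \<open>w = 0\<close>, where the boundary condition is void.\<close>

definition boundary_restriction :: "(nat \<Rightarrow> real) \<Rightarrow> op_graph" where
  "boundary_restriction w = {(f, lap f) | f. f \<in> maximal_domain \<and> boundary_form f w = 0}"

section \<open>Divergence form of the Laplacian and Green's formula\<close>

lemma b_Suc_pos: "0 < b n (Suc n)"
  by (simp add: b_pos_iff)

lemma b_eq_0: "\<bar>int x - int y\<bar> \<noteq> 1 \<Longrightarrow> b x y = 0"
  using b_nonneg[of x y] b_pos_iff[of x y] by linarith

lemma lap_0: "lap f 0 * m 0 = flux f 0"
proof -
  have "(\<Sum>y. b 0 y * (f 0 - f y)) = (\<Sum>y\<in>{1}. b 0 y * (f 0 - f y))"
    by (rule suminf_finite) (auto simp: b_eq_0)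
  then show ?thesis using m_pos[of 0] by (simp add: formal_laplacian_def flux_def)
qed

text \<open>Weighted by \<open>m\<close>, the Laplacian is a difference of fluxes, with no incoming
  flux at 0. Hence the sums in \<open>sum_lap\<close> and \<open>green\<close> telescope.\<close>

lemma lap_Suc: "lap f (Suc n) * m (Suc n) = flux f (Suc n) - flux f n"
proof -
  have "(\<Sum>y. b (Suc n) y * (f (Suc n) - f y)) = (\<Sum>y\<in>{n, Suc (Suc n)}. b (Suc n) y * (f (Suc n) - f y))"
    by (rule suminf_finite) (auto intro!: b_eq_0)
  then show ?thesis using m_pos[of "Suc n"] b_sym[of n "Suc n"]
    by (simp add: formal_laplacian_def flux_def algebra_simps)
qed

lemma sum_lap: "(\<Sum>x\<le>n. lap f x * m x) = flux f n"
  by (induction n) (simp_all add: lap_0 lap_Suc)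

lemma green: "(\<Sum>x\<le>n. lap f x * g x * m x - f x * lap g x * m x) = wronskian f g n"
proof (induction n)
  case 0
  show ?case using lap_0[of f] lap_0[of g] by (simp add: wronskian_def) (metis mult.assoc mult.commute)
next
  case (Suc n)
  have "lap f (Suc n) * g (Suc n) * m (Suc n) - f (Suc n) * lap g (Suc n) * m (Suc n)
      = (lap f (Suc n) * m (Suc n)) * g (Suc n) - f (Suc n) * (lap g (Suc n) * m (Suc n))"
    by simp
  also have "\<dots> = wronskian f g (Suc n) - wronskian f g n"
    unfolding lap_Suc by (simp add: wronskian_def flux_def algebra_simps)
  finally show ?case using Suc by simp
qed

text \<open>Each Wronskian is the determinant of two of the vectors (flux, value) at
  \<open>n\<close>; this is the quadratic relation among the minors of a 2 by 4 matrix.\<close>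

lemma plucker:
  "wronskian f g n * wronskian h k n
    = wronskian f h n * wronskian g k n - wronskian f k n * wronskian g h n"
  by (simp add: wronskian_def algebra_simps)

lemma wronskian_self: "wronskian f f n = 0"
  by (simp add: wronskian_def)

lemma wronskian_swap: "wronskian g f n = - wronskian f g n"
  by (simp add: wronskian_def)

lemma wronskian_finite_support:
  assumes "\<And>x. N \<le> x \<Longrightarrow> f x = 0" "N \<le> n"
  shows "wronskian f g n = 0"
  using assms by (simp add: wronskian_def flux_def)

lemma lap_add: "lap (\<lambda>x. f x + g x) = (\<lambda>x. lap f x + lap g x)"
proof
  fix x
  have "lap (\<lambda>x. f x + g x) x * m x = (lap f x + lap g x) * m x"
    by (cases x) (simp_all add: lap_0 lap_Suc distrib_right, simp_all add: flux_def algebra_simps)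
  then show "lap (\<lambda>x. f x + g x) x = lap f x + lap g x" using m_pos[of x] by simp
qed

lemma lap_scale: "lap (\<lambda>x. c * f x) = (\<lambda>x. c * lap f x)"
proof
  fix x
  have "lap (\<lambda>x. c * f x) x * m x = c * (lap f x * m x)"
    by (cases x) (simp_all add: lap_0 lap_Suc, simp_all add: flux_def algebra_simps)
  then show "lap (\<lambda>x. c * f x) x = c * lap f x" using m_pos[of x] by simp
qed

lemma lap_finitely_supported:
  assumes "f \<in> finitely_supported"
  shows "lap f \<in> finitely_supported"
proof -
  obtain N where N: "\<And>x. N \<le> x \<Longrightarrow> f x = 0" using finitely_supported_bound[OF assms] by blast
  have "lap f x = 0" if x: "N < x" for x
  proof -
    obtain n where n: "x = Suc n" using x by (cases x) auto
    have "lap f x * m x = 0" unfolding n lap_Suc using N x n by (simp add: flux_def)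
    then show ?thesis using m_pos[of x] by simp
  qed
  then have "{x. lap f x \<noteq> 0} \<subseteq> {..N}" by (force simp: not_less[symmetric])
  then show ?thesis unfolding finitely_supported_def using finite_subset by blast
qed

lemma finitely_supported_subset_maximal: "finitely_supported \<subseteq> maximal_domain"
  using finitely_supported_subset_l2 lap_finitely_supported by (auto simp: maximal_domain_def)

section \<open>Boundary form at infinity\<close>

lemma wronskian_tendsto:
  assumes "f \<in> maximal_domain" "g \<in> maximal_domain"
  shows "wronskian f g \<longlonglongrightarrow> boundary_form f g"
proof -
  have "summable (\<lambda>x. lap f x * g x * m x)" "summable (\<lambda>x. f x * lap g x * m x)"
    using assms by (auto simp: maximal_domain_def intro: l2_mult_summable)
  then have "(\<lambda>n. \<Sum>x\<le>n. lap f x * g x * m x - f x * lap g x * m x)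
      \<longlonglongrightarrow> (\<Sum>x. lap f x * g x * m x) - (\<Sum>x. f x * lap g x * m x)"
    unfolding sum_subtractf by (intro tendsto_diff summable_LIMSEQ')
  then show ?thesis by (simp add: green boundary_form_def l2_inner_def)
qed

lemma boundary_form_unique:
  assumes "f \<in> maximal_domain" "g \<in> maximal_domain" "wronskian f g \<longlonglongrightarrow> L"
  shows "boundary_form f g = L"
  using LIMSEQ_unique[OF wronskian_tendsto[OF assms(1,2)] assms(3)] .

lemma boundary_form_self: "f \<in> maximal_domain \<Longrightarrow> boundary_form f f = 0"
  using wronskian_tendsto[of f f] by (simp add: tendsto_cong[OF always_eventually[OF allI[OF wronskian_self]]] LIMSEQ_const_iff)

lemma boundary_form_swap:
  assumes "f \<in> maximal_domain" "g \<in> maximal_domain"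
  shows "boundary_form g f = - boundary_form f g"
  using assms wronskian_tendsto[THEN tendsto_minus, OF assms]
  by (intro boundary_form_unique) (simp_all add: wronskian_swap[of f g, abs_def])

lemma boundary_form_plucker:
  assumes "f \<in> maximal_domain" "g \<in> maximal_domain" "h \<in> maximal_domain" "k \<in> maximal_domain"
  shows "boundary_form f g * boundary_form h k
    = boundary_form f h * boundary_form g k - boundary_form f k * boundary_form g h"
proof (rule LIMSEQ_unique)
  show "(\<lambda>n. wronskian f g n * wronskian h k n) \<longlonglongrightarrow> boundary_form f g * boundary_form h k"
    using assms by (intro tendsto_mult wronskian_tendsto)
  show "(\<lambda>n. wronskian f g n * wronskian h k n)
      \<longlonglongrightarrow> boundary_form f h * boundary_form g k - boundary_form f k * boundary_form g h"
    unfolding plucker[of f g _ h k]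
    using assms by (intro tendsto_diff tendsto_mult wronskian_tendsto)
qed

lemma boundary_form_finitely_supported:
  assumes "f \<in> finitely_supported"
  shows "boundary_form f g = 0"
proof -
  obtain N where N: "\<And>x. N \<le> x \<Longrightarrow> f x = 0" using finitely_supported_bound[OF assms] by blast
  obtain N' where N': "\<And>x. N' \<le> x \<Longrightarrow> lap f x = 0"
    using finitely_supported_bound[OF lap_finitely_supported[OF assms]] by blast
  define n where "n = max N N'"
  have "l2_inner m (lap f) g = (\<Sum>x\<le>n. lap f x * g x * m x)"
    unfolding l2_inner_def by (rule suminf_finite) (auto simp: N' n_def)
  moreover have "l2_inner m f (lap g) = (\<Sum>x\<le>n. f x * lap g x * m x)"
    unfolding l2_inner_def by (rule suminf_finite) (auto simp: N n_def)
  ultimately have "boundary_form f g = wronskian f g n"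
    by (simp add: boundary_form_def green[symmetric] sum_subtractf)
  also have "\<dots> = 0" using N n_def by (intro wronskian_finite_support) auto
  finally show ?thesis .
qed

section \<open>Adjoints and self-adjoint boundary conditions\<close>

lemma adjoint_minimal_laplacian:
  assumes "(g, h) \<in> adjoint_operator m (minimal_laplacian b m)"
  shows "g \<in> maximal_domain" "h = lap g"
proof -
  have gh: "g \<in> l2 m" "h \<in> l2 m"
    and adj: "\<And>f. f \<in> finitely_supported \<Longrightarrow> l2_inner m (lap f) g = l2_inner m f h"
    using assms by (auto simp: adjoint_operator_def minimal_laplacian_def)
  show "h = lap g"
  proof
    fix x
    \<comment> \<open>Testing against the indicator of a single vertex recovers \<open>h\<close>
      pointwise.\<close>
    define e :: "nat \<Rightarrow> real" where "e y = (if y = x then 1 else 0)" for y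
    have fs: "e \<in> finitely_supported" by (simp add: e_def finitely_supported_def)
    have *: "l2_inner m e k = k x * m x" for k
    proof -
      have "l2_inner m e k = (\<Sum>y\<in>{x}. e y * k y * m y)"
        unfolding l2_inner_def by (rule suminf_finite) (auto simp: e_def)
      then show ?thesis by (simp add: e_def)
    qed
    have "l2_inner m e (lap g) = l2_inner m e h"
      using boundary_form_finitely_supported[OF fs, of g] adj[OF fs] by (simp add: boundary_form_def)
    then show "h x = lap g x" using m_pos[of x] by (simp add: *)
  qed
  with gh show "g \<in> maximal_domain" by (simp add: maximal_domain_def)
qed

lemma adjoint_antimono: "A \<subseteq> B \<Longrightarrow> adjoint_operator m B \<subseteq> adjoint_operator m A"
  by (fastforce simp: adjoint_operator_def)

lemma minimal_subset_boundary_restriction: "minimal_laplacian b m \<subseteq> boundary_restriction w"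
  using finitely_supported_subset_maximal boundary_form_finitely_supported
  by (auto simp: minimal_laplacian_def boundary_restriction_def)

lemma boundary_form_add:
  assumes "f \<in> maximal_domain" "g \<in> maximal_domain" "w \<in> maximal_domain"
  shows "(\<lambda>x. f x + g x) \<in> maximal_domain"
    "boundary_form (\<lambda>x. f x + g x) w = boundary_form f w + boundary_form g w"
proof -
  show 1: "(\<lambda>x. f x + g x) \<in> maximal_domain"
    using assms by (auto simp: maximal_domain_def lap_add intro: l2_add)
  have "wronskian (\<lambda>x. f x + g x) w = (\<lambda>n. wronskian f w n + wronskian g w n)"
    by (auto simp: wronskian_def flux_def algebra_simps)
  then show "boundary_form (\<lambda>x. f x + g x) w = boundary_form f w + boundary_form g w"
    using assms 1 by (intro boundary_form_unique) (auto intro: tendsto_add wronskian_tendsto)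
qed

lemma boundary_form_scale:
  assumes "f \<in> maximal_domain" "w \<in> maximal_domain"
  shows "(\<lambda>x. c * f x) \<in> maximal_domain"
    "boundary_form (\<lambda>x. c * f x) w = c * boundary_form f w"
proof -
  show 1: "(\<lambda>x. c * f x) \<in> maximal_domain"
    using assms by (auto simp: maximal_domain_def lap_scale intro: l2_scale)
  have "wronskian (\<lambda>x. c * f x) w = (\<lambda>n. c * wronskian f w n)"
    by (auto simp: wronskian_def flux_def algebra_simps)
  then show "boundary_form (\<lambda>x. c * f x) w = c * boundary_form f w"
    using assms 1 by (intro boundary_form_unique) (auto intro: tendsto_mult_left wronskian_tendsto)
qed

lemma linear_boundary_restriction:
  assumes w: "w \<in> maximal_domain"
  shows "linear_operator m (boundary_restriction w)"
proof -
  have z: "(\<lambda>x. 0) \<in> finitely_supported" by (simp add: finitely_supported_def)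
  have lz: "lap (\<lambda>x. 0) = (\<lambda>x. 0)" using lap_scale[of 0 "\<lambda>x. 0"] by simp
  have "(\<lambda>x. 0, \<lambda>x. 0) \<in> boundary_restriction w"
    using minimal_subset_boundary_restriction[of w] z lz by (force simp: minimal_laplacian_def)
  then show ?thesis
    using boundary_form_add[OF _ _ w] boundary_form_scale[OF _ w]
    unfolding linear_operator_def
    by (auto simp: boundary_restriction_def single_valued_def lap_add lap_scale maximal_domain_def)
qed

text \<open>The function \<open>w\<close> satisfies its own boundary condition, so pairing with
  \<open>w\<close> forces that condition on every element of the adjoint. The converse inclusion is
  the symmetry \<open>sym\<close>.\<close>

lemma self_adjoint_boundary_restriction:
  assumes w: "w \<in> maximal_domain"
    and sym: "\<And>f g. f \<in> maximal_domain \<Longrightarrow> g \<in> maximal_domain \<Longrightarrow>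
      boundary_form f w = 0 \<Longrightarrow> boundary_form g w = 0 \<Longrightarrow> boundary_form f g = 0"
  shows "self_adjoint m (boundary_restriction w)"
proof -
  have "l2_dense m (Domain (boundary_restriction w))"
    using minimal_subset_boundary_restriction[of w]
    by (intro finitely_supported_dense)
      (auto simp: minimal_laplacian_def boundary_restriction_def maximal_domain_def Domain_iff subset_iff)
  moreover have "adjoint_operator m (boundary_restriction w) = boundary_restriction w"
  proof (intro equalityI subrelI)
    fix g h assume gh: "(g, h) \<in> adjoint_operator m (boundary_restriction w)"
    then have "(g, h) \<in> adjoint_operator m (minimal_laplacian b m)"
      using adjoint_antimono[OF minimal_subset_boundary_restriction] by blast
    note g = adjoint_minimal_laplacian[OF this]
    have "(w, lap w) \<in> boundary_restriction w"
      using w boundary_form_self by (auto simp: boundary_restriction_def)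
    then have "boundary_form w g = 0"
      using gh g(2) by (auto simp: adjoint_operator_def boundary_form_def)
    then have "boundary_form g w = 0" using boundary_form_swap[OF w g(1)] by simp
    with g show "(g, h) \<in> boundary_restriction w" by (auto simp: boundary_restriction_def)
  next
    fix g h assume gh: "(g, h) \<in> boundary_restriction w"
    then have "boundary_form f g = 0" if "(f, f') \<in> boundary_restriction w" for f f'
      using that sym by (auto simp: boundary_restriction_def)
    with gh show "(g, h) \<in> adjoint_operator m (boundary_restriction w)"
      by (fastforce simp: boundary_restriction_def adjoint_operator_def maximal_domain_def boundary_form_def)
  qed
  ultimately show ?thesis
    unfolding self_adjoint_def using linear_boundary_restriction[OF w] by blast
qed

text \<open>If the maximal Laplacian \<open>T\<close> is symmetric, every self-adjoint extension \<open>B\<close> satisfies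
  \<open>B \<subseteq> T \<subseteq> T\<^sup>* \<subseteq> B\<^sup>* = B\<close>.\<close>

lemma essentially_self_adjointI:
  assumes sym: "\<And>f g. f \<in> maximal_domain \<Longrightarrow> g \<in> maximal_domain \<Longrightarrow> boundary_form f g = 0"
  shows "essentially_self_adjoint m (minimal_laplacian b m)"
  unfolding essentially_self_adjoint_def
proof (rule ex1I)
  let ?T = "boundary_restriction (\<lambda>x. 0)"
  have z: "(\<lambda>x. 0) \<in> maximal_domain"
    using finitely_supported_subset_maximal by (auto simp: finitely_supported_def)
  have T: "self_adjoint m ?T"
    by (intro self_adjoint_boundary_restriction z sym)
  then show "self_adjoint m ?T \<and> minimal_laplacian b m \<subseteq> ?T"
    using minimal_subset_boundary_restriction by blast
  fix B assume B: "self_adjoint m B \<and> minimal_laplacian b m \<subseteq> B"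
  have "B \<subseteq> ?T"
  proof (rule subrelI)
    fix g h assume "(g, h) \<in> B"
    then have "(g, h) \<in> adjoint_operator m (minimal_laplacian b m)"
      using B adjoint_antimono unfolding self_adjoint_def by blast
    then show "(g, h) \<in> ?T"
      using adjoint_minimal_laplacian sym[OF _ z] by (auto simp: boundary_restriction_def)
  qed
  moreover have "?T \<subseteq> B"
    using adjoint_antimono[OF calculation] T B by (simp add: self_adjoint_def)
  ultimately show "B = ?T" by simp
qed

section \<open>The square-summability of the resistance\<close>

text \<open>Harmonic away from \<open>0\<close>; together with the constants it spans the solutions of
  \<open>\<Delta>u(x) = 0\<close> for \<open>x \<ge> 1\<close>.\<close>

definition resistance :: "nat \<Rightarrow> real" where
  "resistance n = (\<Sum>k<n. 1 / b k (Suc k))"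

lemma resistance_mono: "i \<le> n \<Longrightarrow> resistance i \<le> resistance n"
  unfolding resistance_def by (intro sum_mono2) (auto simp: b_nonneg)

lemma resistance_nonneg: "0 \<le> resistance n"
  unfolding resistance_def by (intro sum_nonneg) (auto simp: b_nonneg)

lemma flux_resistance: "flux resistance n = - 1"
  using b_Suc_pos[of n] by (simp add: flux_def resistance_def)

lemma resistance_maximal:
  assumes "resistance \<in> l2 m"
  shows "resistance \<in> maximal_domain"
proof -
  \<comment> \<open>The flux is constantly -1, so its differences vanish at every vertex but
    0.\<close>
  have "lap resistance x = 0" if x: "x \<noteq> 0" for x
  proof -
    obtain n where n: "x = Suc n" using x by (cases x) auto
    have "lap resistance x * m x = 0" unfolding n lap_Suc by (simp add: flux_resistance)
    then show ?thesis using m_pos[of x] by simp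
  qed
  then have "{x. lap resistance x \<noteq> 0} \<subseteq> {0}" by auto
  then have "lap resistance \<in> finitely_supported"
    unfolding finitely_supported_def using finite_subset by blast
  with assms show ?thesis using finitely_supported_subset_l2 by (auto simp: maximal_domain_def)
qed

lemma const_maximal:
  assumes "resistance \<in> l2 m"
  shows "(\<lambda>x. 1) \<in> maximal_domain"
proof -
  have r1: "0 < resistance 1" using b_Suc_pos[of 0] by (simp add: resistance_def)
  \<comment> \<open>From vertex 1 on, the rescaled resistance dominates 1; the indicator of 0 covers
    the vertex where the resistance vanishes.\<close>
  define e :: "nat \<Rightarrow> real" where "e x = (if x = 0 then 1 else 0)" for x
  have "e \<in> l2 m" using finitely_supported_subset_l2[of m] by (auto simp: e_def finitely_supported_def)
  then have "(\<lambda>x. e x + 1 / resistance 1 * resistance x) \<in> l2 m"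
    using assms by (intro l2_add l2_scale)
  moreover have "\<bar>1\<bar> \<le> \<bar>e x + 1 / resistance 1 * resistance x\<bar>" for x
    using resistance_mono[of 1 x] resistance_nonneg[of x] r1
    by (cases "x = 0") (auto simp: e_def field_simps)
  ultimately have c: "(\<lambda>x. 1) \<in> l2 m" by (rule l2_mono)
  have "lap (\<lambda>x. 1) = (\<lambda>x. 0)" by (simp add: formal_laplacian_def fun_eq_iff)
  with c show ?thesis by (simp add: maximal_domain_def l2_zero)
qed

text \<open>The boundary conditions at infinity given by \<open>1\<close> and by the resistance both define self-adjoint
  extensions; they differ because the Wronskian of the two functions is \<open>1\<close>.\<close>

lemma not_essentially_self_adjoint:
  assumes "resistance \<in> l2 m"
  shows "\<not> essentially_self_adjoint m (minimal_laplacian b m)"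
proof -
  let ?u = "\<lambda>x::nat. 1::real"
  note u = const_maximal[OF assms] and v = resistance_maximal[OF assms]
  have uv: "boundary_form ?u resistance = 1"
    using u v by (rule boundary_form_unique) (simp add: wronskian_def[abs_def] flux_resistance, simp add: flux_def)
  \<comment> \<open>In the Pluecker identity with 1 and the resistance the left side is
    \<open>boundary_form f g\<close>, and each product on the right has a factor with
    \<open>w\<close>.\<close>
  have "boundary_form f g = 0"
    if "f \<in> maximal_domain" "g \<in> maximal_domain" "w \<in> {?u, resistance}"
      "boundary_form f w = 0" "boundary_form g w = 0" for f g w
    using boundary_form_plucker[OF that(1,2) u v] that uv by auto
  then have sa: "self_adjoint m (boundary_restriction w)" if "w \<in> {?u, resistance}" for w
    using that u v by (intro self_adjoint_boundary_restriction) auto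
  have "(?u, lap ?u) \<in> boundary_restriction ?u"
    using u boundary_form_self by (auto simp: boundary_restriction_def)
  moreover have "(?u, lap ?u) \<notin> boundary_restriction resistance"
    using uv by (auto simp: boundary_restriction_def)
  ultimately have "boundary_restriction ?u \<noteq> boundary_restriction resistance" by metis
  then show ?thesis unfolding essentially_self_adjoint_def
    using sa minimal_subset_boundary_restriction by (metis insertI1 insertI2)
qed

text \<open>If \<open>\<Delta>f\<close> has nonzero total mass, the flux of \<open>f\<close> is eventually bounded away from \<open>0\<close>, so that
  \<open>f\<close> grows at least like the resistance.\<close>

lemma flux_limit_zero:
  assumes f: "f \<in> l2 m" and one: "(\<lambda>x. 1) \<in> l2 m" and r: "resistance \<notin> l2 m"
    and lim: "flux f \<longlonglongrightarrow> p"
  shows "p = 0"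
proof (rule ccontr)
  assume "p \<noteq> 0"
  define e where "e = \<bar>p\<bar> / 2"
  have e: "0 < e" using \<open>p \<noteq> 0\<close> by (simp add: e_def)
  have "(\<lambda>n. sgn p * flux f n) \<longlonglongrightarrow> sgn p * p" by (intro tendsto_mult_left lim)
  moreover have "e < sgn p * p" using \<open>p \<noteq> 0\<close> by (auto simp: e_def sgn_if abs_if)
  ultimately have "\<forall>\<^sub>F n in sequentially. e < sgn p * flux f n" by (rule order_tendstoD)
  then obtain N where N: "\<And>n. N \<le> n \<Longrightarrow> e < sgn p * flux f n"
    unfolding eventually_sequentially by blast
  define K where "K = sgn p * f N + e * resistance N"
  \<comment> \<open>Each step past \<open>N\<close> lowers \<open>sgn p * f n\<close> by at least
    \<open>e / b n (Suc n)\<close>, exactly the rise of \<open>e * resistance n\<close>.\<close>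
  have grow: "sgn p * f n + e * resistance n \<le> K" if "N \<le> n" for n
    using that
  proof (induction n rule: dec_induct)
    case base
    show ?case by (simp add: K_def)
  next
    case (step n)
    have "e * (1 / b n (Suc n)) \<le> sgn p * flux f n * (1 / b n (Suc n))"
      using N[OF step(1)] by (intro mult_right_mono) (auto simp: b_nonneg)
    also have "\<dots> = sgn p * f n - sgn p * f (Suc n)"
      using b_Suc_pos[of n] by (simp add: flux_def field_simps)
    finally show ?case using step.IH by (simp add: resistance_def algebra_simps)
  qed
  \<comment> \<open>The first summand serves the indices from \<open>N\<close> on, the second the
    earlier ones.\<close>
  define c where "c = \<bar>K\<bar> / e + resistance N"
  have "(\<lambda>x. \<bar>f x\<bar>) \<in> l2 m" using f by (simp add: l2_def)
  then have "(\<lambda>x. 1 / e * \<bar>f x\<bar> + c * 1) \<in> l2 m"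
    using one by (intro l2_add l2_scale)
  moreover have "\<bar>resistance n\<bar> \<le> \<bar>1 / e * \<bar>f n\<bar> + c * 1\<bar>" for n
  proof -
    have "resistance n \<le> 1 / e * \<bar>f n\<bar> + c"
    proof (cases "N \<le> n")
      case True
      have "- \<bar>f n\<bar> \<le> sgn p * f n" by (auto simp: sgn_if)
      with grow[OF True] have "e * resistance n \<le> \<bar>f n\<bar> + \<bar>K\<bar>" by linarith
      then have "resistance n \<le> (\<bar>f n\<bar> + \<bar>K\<bar>) / e" using e by (simp add: field_simps)
      then show ?thesis using resistance_nonneg[of N] by (simp add: c_def add_divide_distrib)
    next
      case False
      then have "resistance n \<le> resistance N" by (intro resistance_mono) simp
      moreover have "0 \<le> 1 / e * \<bar>f n\<bar>" "0 \<le> \<bar>K\<bar> / e" using e by auto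
      ultimately show ?thesis by (simp add: c_def)
    qed
    then show ?thesis using resistance_nonneg[of n] by simp
  qed
  ultimately have "resistance \<in> l2 m" by (rule l2_mono)
  with r show False ..
qed

section \<open>Vanishing of Wronskians at infinity\<close>

lemma boundary_form_zero_if_flux_bound:
  assumes fg: "f \<in> maximal_domain" "g \<in> maximal_domain"
    and F: "\<And>n. (flux f n)\<^sup>2 \<le> H * B n" and G: "\<And>n. (flux g n)\<^sup>2 \<le> H * B n"
    and H: "0 < H"
    and small: "\<And>C N. 0 < C \<Longrightarrow> \<exists>n\<ge>N. ((f n)\<^sup>2 + (g n)\<^sup>2) * B n < C"
  shows "boundary_form f g = 0"
proof (rule ccontr)
  assume nz: "boundary_form f g \<noteq> 0"
  define L where "L = (boundary_form f g)\<^sup>2"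
  have L: "0 < L" using nz by (simp add: L_def)
  have "(\<lambda>n. (wronskian f g n)\<^sup>2) \<longlonglongrightarrow> L"
    unfolding L_def by (intro tendsto_power wronskian_tendsto fg)
  then have "\<forall>\<^sub>F n in sequentially. L / 2 < (wronskian f g n)\<^sup>2"
    by (rule order_tendstoD) (use L in simp)
  then obtain N where N: "\<And>n. N \<le> n \<Longrightarrow> L / 2 < (wronskian f g n)\<^sup>2"
    unfolding eventually_sequentially by blast
  \<comment> \<open>The two flux bounds together cost a factor \<open>2 * H\<close>, so this choice
    brings the squared Wronskian below \<open>L / 2\<close>.\<close>
  obtain n where n: "N \<le> n" "((f n)\<^sup>2 + (g n)\<^sup>2) * B n < L / (4 * H)"
    using small[of "L / (4 * H)" N] L H by auto
  \<comment> \<open>Lagrange's identity for the vectors of values and of fluxes of \<open>f\<close>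
    and \<open>g\<close>.\<close>
  have "(wronskian f g n)\<^sup>2 \<le> ((f n)\<^sup>2 + (g n)\<^sup>2) * ((flux f n)\<^sup>2 + (flux g n)\<^sup>2)"
  proof -
    have "((f n)\<^sup>2 + (g n)\<^sup>2) * ((flux f n)\<^sup>2 + (flux g n)\<^sup>2)
        = (wronskian f g n)\<^sup>2 + (f n * flux f n + g n * flux g n)\<^sup>2"
      by (simp add: wronskian_def power2_eq_square algebra_simps)
    then show ?thesis by simp
  qed
  also have "\<dots> \<le> ((f n)\<^sup>2 + (g n)\<^sup>2) * (2 * H * B n)"
    using F[of n] G[of n] by (intro mult_left_mono) auto
  also have "\<dots> = 2 * H * (((f n)\<^sup>2 + (g n)\<^sup>2) * B n)" by simp
  also have "\<dots> < 2 * H * (L / (4 * H))" using n(2) H by (intro mult_strict_left_mono) auto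
  also have "\<dots> = L / 2" using H by simp
  finally show False using N[OF n(1)] by simp
qed

lemma limit_point:
  assumes r: "resistance \<notin> l2 m" and f: "f \<in> maximal_domain" and g: "g \<in> maximal_domain"
  shows "boundary_form f g = 0"
proof -
  define E where "E h = (\<Sum>x. (lap h x)\<^sup>2 * m x)" for h
  \<comment> \<open>Adding 1 keeps \<open>H\<close> positive, as the division by
    \<open>4 * H\<close> requires.\<close>
  define H where "H = E f + E g + 1"
  have s: "summable (\<lambda>x. (lap h x)\<^sup>2 * m x)" if "h \<in> {f, g}" for h
    using that f g by (auto simp: maximal_domain_def l2_def)
  have E: "0 \<le> E h" if "h \<in> {f, g}" for h
    unfolding E_def using s[OF that] by (intro suminf_nonneg) (auto simp: m_nonneg)
  have EH: "E h \<le> H" if "h \<in> {f, g}" for h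
    using that E[of f] E[of g] by (auto simp: H_def)
  have H: "0 < H" using E[of f] E[of g] by (simp add: H_def)
  have sa: "summable (\<lambda>x. ((f x)\<^sup>2 + (g x)\<^sup>2) * m x)"
    using f g by (auto simp: maximal_domain_def l2_def distrib_right intro: summable_add)
  show ?thesis
  proof (cases "summable m")
    case False
    have "(flux h n)\<^sup>2 \<le> H * (\<Sum>x\<le>n. m x)" if h: "h \<in> {f, g}" for h n
    proof -
      have "(flux h n)\<^sup>2 \<le> (\<Sum>x\<le>n. (lap h x)\<^sup>2 * m x) * (\<Sum>x\<le>n. m x)"
        unfolding sum_lap[symmetric] by (rule weighted_sum_cauchy_schwarz[OF m_nonneg])
      also have "\<dots> \<le> H * (\<Sum>x\<le>n. m x)"
      proof (rule mult_right_mono)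
        have "(\<Sum>x\<le>n. (lap h x)\<^sup>2 * m x) \<le> E h"
          unfolding E_def by (rule sum_le_suminf[OF s[OF h]]) (auto simp: m_nonneg)
        with EH[OF h] show "(\<Sum>x\<le>n. (lap h x)\<^sup>2 * m x) \<le> H" by linarith
      qed (intro sum_nonneg m_nonneg)
      finally show ?thesis .
    qed
    then show ?thesis
      using abel_dini_partial_sums[OF m_nonneg _ sa False]
      by (intro boundary_form_zero_if_flux_bound[OF f g _ _ H, where B = "\<lambda>n. \<Sum>x\<le>n. m x"]) auto
  next
    case True
    then have one: "(\<lambda>x. 1) \<in> l2 m" by (simp add: l2_def)
    have "(flux h n)\<^sup>2 \<le> H * (\<Sum>i. m (i + Suc n))" if h: "h \<in> {f, g}" for h n
    proof -
      let ?k = "\<lambda>x. lap h x * m x"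
      have hl: "h \<in> l2 m" "lap h \<in> l2 m" using h f g by (auto simp: maximal_domain_def)
      have sk: "summable ?k" using l2_mult_summable[OF hl(2) one] by simp
      have "flux h \<longlonglongrightarrow> suminf ?k"
        using summable_LIMSEQ'[OF sk] by (simp add: sum_lap)
      \<comment> \<open>Zero total mass is what turns the flux, a partial sum, into minus a tail, so
        that the small mass beyond \<open>n\<close> bounds it.\<close>
      then have "suminf ?k = 0" by (rule flux_limit_zero[OF hl(1) one r])
      moreover have "suminf ?k = (\<Sum>i. ?k (i + Suc n)) + flux h n"
        using suminf_split_initial_segment[OF sk, of "Suc n"]
        by (simp add: lessThan_Suc_atMost sum_lap)
      ultimately have "flux h n = - (\<Sum>i. ?k (i + Suc n))" by linarith
      then have "(flux h n)\<^sup>2 = (\<Sum>i. ?k (i + Suc n))\<^sup>2" by (simp only: power2_minus)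
      also have "\<dots> \<le> (\<Sum>i. (lap h (i + Suc n))\<^sup>2 * m (i + Suc n)) * (\<Sum>i. m (i + Suc n))"
        using s[OF h] sk True
          summable_iff_shift[of "\<lambda>x. (lap h x)\<^sup>2 * m x" "Suc n"]
          summable_iff_shift[of ?k "Suc n"] summable_iff_shift[of m "Suc n"]
        by (intro weighted_suminf_cauchy_schwarz m_nonneg) auto
      also have "\<dots> \<le> H * (\<Sum>i. m (i + Suc n))"
      proof (rule mult_right_mono)
        have "E h = (\<Sum>i. (lap h (i + Suc n))\<^sup>2 * m (i + Suc n)) + (\<Sum>x<Suc n. (lap h x)\<^sup>2 * m x)"
          unfolding E_def by (rule suminf_split_initial_segment[OF s[OF h]])
        moreover have "0 \<le> (\<Sum>x<Suc n. (lap h x)\<^sup>2 * m x)"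
          by (intro sum_nonneg) (auto simp: m_nonneg)
        ultimately show "(\<Sum>i. (lap h (i + Suc n))\<^sup>2 * m (i + Suc n)) \<le> H"
          using EH[OF h] by linarith
        show "0 \<le> (\<Sum>i. m (i + Suc n))"
          using True summable_iff_shift[of m "Suc n"] by (intro suminf_nonneg m_nonneg) auto
      qed
      finally show ?thesis .
    qed
    then show ?thesis
      using abel_dini_tails[OF m_pos _ sa True]
      by (intro boundary_form_zero_if_flux_bound[OF f g _ _ H, where B = "\<lambda>n. \<Sum>i. m (i + Suc n)"]) auto
  qed
qed

lemma essentially_self_adjoint_iff:
  "essentially_self_adjoint m (minimal_laplacian b m) \<longleftrightarrow> resistance \<notin> l2 m"
  using not_essentially_self_adjoint essentially_self_adjointI limit_point by blast

lemma resistance_in_l2_iff: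
  "resistance \<in> l2 m \<longleftrightarrow> (\<Sum>r. ennreal ((\<Sum>k=0..r. 1 / b k (k + 1))\<^sup>2 * m (r + 1))) \<noteq> \<infinity>"
proof -
  let ?t = "\<lambda>r. (\<Sum>k=0..r. 1 / b k (k + 1))\<^sup>2 * m (r + 1)"
  \<comment> \<open>The term of index \<open>r\<close> belongs to vertex \<open>r + 1\<close>;
    leaving out vertex 0 does not affect convergence.\<close>
  have t: "(resistance (Suc r))\<^sup>2 * m (Suc r) = ?t r" for r
    by (simp add: resistance_def lessThan_Suc_atMost atLeast0AtMost)
  have "resistance \<in> l2 m \<longleftrightarrow> summable ?t"
    unfolding l2_def t[symmetric] mem_Collect_eq
    by (rule summable_Suc_iff[symmetric])
  also have "\<dots> \<longleftrightarrow> (\<Sum>r. ennreal (?t r)) \<noteq> \<infinity>"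
  proof -
    have t_nonneg: "0 \<le> ?t r" for r by (intro mult_nonneg_nonneg m_nonneg) simp
    show ?thesis
      unfolding infinity_ennreal_def
      by (rule iffI, rule ennreal_suminf_neq_top[OF _ t_nonneg], assumption,
          rule summable_suminf_not_top[OF t_nonneg])
  qed
  finally show ?thesis .
qed

end

theorem theorem4p2:
  fixes b :: "nat \<Rightarrow> nat \<Rightarrow> real" and m :: "nat \<Rightarrow> real"
  assumes "birth_death_chain b m"
  shows "essentially_self_adjoint m (minimal_laplacian b m) \<longleftrightarrow>
    (\<Sum>r. ennreal ((\<Sum>k=0..r. 1 / b k (k + 1))\<^sup>2 * m (r + 1))) = \<infinity>"
  using birth_death_chain.essentially_self_adjoint_iff[OF assms]
    birth_death_chain.resistance_in_l2_iff[OF assms] by blast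

end
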